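(* Let $\mu:\mathcal{C}\to\mathbb{R}_0^+$ be a fuzzy measure, let $\nu:\mathcal{E}\to\mathbb{R}_0^+$ be a set function with $\nu(\emptyset)=0$, and let $f:S\to\mathbb{R}_0^+$ be $\mu$-measurable. If $A,B\in\mathcal{C}$ satisfy $A\subseteq B$ and $f\in G_{RL}(\nu,\mu,A)\cap G_{RL}(\nu,\mu,B)$, then $$\int_A^{*} f\,d(\nu,\mu)\le\int_B^{*} f\,d(\nu,\mu).$$
   Context: $\mathbb{R}_0^+=[0,\infty)$. $S$ is a nonempty, at least countable set, $\mathcal{C}$ is a $\sigma$-algebra of subsets of $S$, and $\mathcal{E}$ is a $\sigma$-algebra of subsets of $\mathbb{R}_0^+$ with $\{0\}\in\mathcal{E}$. Set functions on $\mathcal{C}$ and $\mathcal{E}$ have values in $\mathbb{R}_0^+$, vanish on $\emptyset$, and are not assumed additive or monotone unless stated. $\mu$ is a fuzzy measure if $\mu(\emptyset)=0$ and $\mu(B)\le\mu(C)$ whenever $B\subseteq C$, $B,C\in\mathcal{C}$. Measurability: $f:S\to\mathbb{R}_0^+$ is $\mu$-measurable if it is $\mathcal{C}$-measurable, i.e. $E_f^\alpha:=\{s\in S: f(s)\ge\alpha\}\in\mathcal{C}$ for all $\alpha\ge 0$. Riemann-Lebesgue (RL) integral: for two countable partitions $P,P'$ of $\mathbb{R}_0^+$, $P'$ is finer than $P$ if every set of $P'$ is included in some set of $P$. A function $g:\mathbb{R}_0^+\to\mathbb{R}$ is $\nu$-RL integrable if there is $a\in\mathbb{R}$ such that for every $\varepsilon>0$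 there is a countable partition $\Pi_\varepsilon$ of $\mathbb{R}_0^+$ into sets of $\mathcal{E}$ such that for every countable partition $\Pi=(E_n)_n$ of $\mathbb{R}_0^+$ into sets of $\mathcal{E}$ finer than $\Pi_\varepsilon$: $g$ is bounded on every $E_n$ with $\nu(E_n)>0$, and for every choice of $s_n\in E_n$ the series $\sum_n g(s_n)\nu(E_n)$ converges absolutely and $|\sum_n g(s_n)\nu(E_n)-a|<\varepsilon$. Then $a$ is unique and is denoted $(RL)\int_{[0,\infty)}g\,d\nu$. Generalized decomposition integral: for a $\mu$-measurable $f:S\to\mathbb{R}_0^+$ and $A\in\mathcal{C}$ put $u_{f,\mu}^{A}(\alpha)=\mu(E_f^\alpha\cap A)$, $\alpha\ge 0$. $f$ is $(\nu,\mu)$-integrable on $A$ if $u_{f,\mu}^A$ is $\nu$-RL integrable on $\mathbb{R}_0^+$, and then $\int_A^{*}f\,d(\nu,\mu):=(RL)\int_{[0,\infty)}u_{f,\mu}^A\,d\nu$. $G_{RL}(\nu,\mu,A)$ is the set of all $\mu$-measurable $f:S\to\mathbb{R}_0^+$ that are $(\nu,\mu)$-integrable on $A$ (with finite integral). *)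

theory Defs
  imports "HOL-Analysis.Analysis" "HOL-Library.Disjoint_Sets"
begin

text \<open>Functions and set functions are represented by total functions; only the values on
  the points of \<open>S\<close>, on \<open>{0..}\<close>, and on the members of the respective \<open>\<sigma>\<close>-algebra matter.\<close>

definition nonneg_set_function :: "'a set set \<Rightarrow> ('a set \<Rightarrow> real) \<Rightarrow> bool" where
  "nonneg_set_function \<C> m \<longleftrightarrow> (\<forall>X\<in>\<C>. 0 \<le> m X) \<and> m {} = 0"

definition fuzzy_measure :: "'a set set \<Rightarrow> ('a set \<Rightarrow> real) \<Rightarrow> bool" where
  "fuzzy_measure \<C> \<mu> \<longleftrightarrow> nonneg_set_function \<C> \<mu> \<and>
     (\<forall>B\<in>\<C>. \<forall>C\<in>\<C>. B \<subseteq> C \<longrightarrow> \<mu> B \<le> \<mu> C)"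

definition level_set :: "'a set \<Rightarrow> ('a \<Rightarrow> real) \<Rightarrow> real \<Rightarrow> 'a set" where
  "level_set S f \<alpha> = {s \<in> S. f s \<ge> \<alpha>}"

definition nonneg_measurable :: "'a set \<Rightarrow> 'a set set \<Rightarrow> ('a \<Rightarrow> real) \<Rightarrow> bool" where
  "nonneg_measurable S \<C> f \<longleftrightarrow> (\<forall>s\<in>S. 0 \<le> f s) \<and> (\<forall>\<alpha>\<ge>0. level_set S f \<alpha> \<in> \<C>)"

text \<open>``Countable'' includes finite; the blocks of a partition are nonempty, so that points
  \<open>s\<^sub>n \<in> E\<^sub>n\<close> can be chosen.\<close>

definition countable_partition :: "real set set \<Rightarrow> real set set \<Rightarrow> bool" where
  "countable_partition \<E> P \<longleftrightarrow> partition_on {0..} P \<and> countable P \<and> P \<subseteq> \<E>"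

text \<open>The series over a partition are absolutely convergent, hence independent of an enumeration
  of its blocks; they are written as sums indexed by the blocks themselves, the chosen point of the
  block \<open>X\<close> being \<open>s X\<close>. The predicate \<^const>\<open>refines\<close> takes the finer partition first.\<close>

definition has_RL_integral ::
    "real set set \<Rightarrow> (real set \<Rightarrow> real) \<Rightarrow> (real \<Rightarrow> real) \<Rightarrow> real \<Rightarrow> bool" where
  "has_RL_integral \<E> \<nu> g a \<longleftrightarrow>
     (\<forall>\<epsilon>>0. \<exists>P\<^sub>\<epsilon>. countable_partition \<E> P\<^sub>\<epsilon> \<and>
        (\<forall>P. countable_partition \<E> P \<and> refines {0..} P P\<^sub>\<epsilon> \<longrightarrow>
           (\<forall>X\<in>P. \<nu> X > 0 \<longrightarrow> bounded (g ` X)) \<and>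
           (\<forall>s. (\<forall>X\<in>P. s X \<in> X) \<longrightarrow>
              (\<lambda>X. \<bar>g (s X) * \<nu> X\<bar>) summable_on P \<and>
              \<bar>(\<Sum>\<^sub>\<infinity>X\<in>P. g (s X) * \<nu> X) - a\<bar> < \<epsilon>)))"

definition RL_integrable ::
    "real set set \<Rightarrow> (real set \<Rightarrow> real) \<Rightarrow> (real \<Rightarrow> real) \<Rightarrow> bool" where
  "RL_integrable \<E> \<nu> g \<longleftrightarrow> (\<exists>a. has_RL_integral \<E> \<nu> g a)"

definition RL_integral ::
    "real set set \<Rightarrow> (real set \<Rightarrow> real) \<Rightarrow> (real \<Rightarrow> real) \<Rightarrow> real" where
  "RL_integral \<E> \<nu> g = (THE a. has_RL_integral \<E> \<nu> g a)"

definition level_fun ::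
    "'a set \<Rightarrow> ('a set \<Rightarrow> real) \<Rightarrow> 'a set \<Rightarrow> ('a \<Rightarrow> real) \<Rightarrow> real \<Rightarrow> real" where
  "level_fun S \<mu> A f \<alpha> = \<mu> (level_set S f \<alpha> \<inter> A)"

definition decomp_integrable ::
    "'a set \<Rightarrow> real set set \<Rightarrow> (real set \<Rightarrow> real) \<Rightarrow> ('a set \<Rightarrow> real) \<Rightarrow> 'a set \<Rightarrow> ('a \<Rightarrow> real) \<Rightarrow> bool"
  where
  "decomp_integrable S \<E> \<nu> \<mu> A f \<longleftrightarrow> RL_integrable \<E> \<nu> (level_fun S \<mu> A f)"

definition decomp_integral ::
    "'a set \<Rightarrow> real set set \<Rightarrow> (real set \<Rightarrow> real) \<Rightarrow> ('a set \<Rightarrow> real) \<Rightarrow> 'a set \<Rightarrow> ('a \<Rightarrow> real) \<Rightarrow> real"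
  where
  "decomp_integral S \<E> \<nu> \<mu> A f = RL_integral \<E> \<nu> (level_fun S \<mu> A f)"

definition G_RL ::
    "'a set \<Rightarrow> 'a set set \<Rightarrow> real set set \<Rightarrow> (real set \<Rightarrow> real) \<Rightarrow> ('a set \<Rightarrow> real) \<Rightarrow> 'a set
      \<Rightarrow> ('a \<Rightarrow> real) set" where
  "G_RL S \<C> \<E> \<nu> \<mu> A = {f. nonneg_measurable S \<C> f \<and> decomp_integrable S \<E> \<nu> \<mu> A f}"

end

theory Submission imports Defs begin

text \<open>Monotonicity of \<open>\<mu>\<close> makes the level function of \<open>A\<close> pointwise at most that of \<open>B\<close>. Over a
  common refinement of partitions chosen for the two integrals, with the same intermediate points,
  the two Riemann sums are then ordered, because \<open>\<nu>\<close> is nonnegative. Letting \<open>\<epsilon>\<close> tend to \<open>0\<close>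
  gives the inequality for any two values of the integrals. Taking equal integrands, the same
  argument gives uniqueness of the value, so that \<^const>\<open>RL_integral\<close> is well defined.\<close>

text \<open>Every block of the common refinement is an intersection of a block of \<open>P\<close>
  with a block of \<open>Q\<close>, and these intersections form a countable subfamily of
  \<open>\<E>\<close>. An inclusion suffices, since empty intersections are discarded.\<close>

lemma countable_partition_common_refinement:
  assumes "sigma_algebra {0..} \<E>" "countable_partition \<E> P" "countable_partition \<E> Q"
  shows "countable_partition \<E> (common_refinement {P, Q})"
proof -
  interpret sigma_algebra "{0..}" \<E> by fact
  let ?I = "(\<lambda>(X, Y). X \<inter> Y) ` (P \<times> Q)"
  have sub: "common_refinement {P, Q} \<subseteq> ?I"
    by (auto simp: common_refinement_def)
  have "?I \<subseteq> \<E>"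
    using assms(2,3) by (auto simp: countable_partition_def)
  moreover have "countable ?I"
    using assms(2,3) by (auto simp: countable_partition_def)
  moreover have "partition_on {0..} (common_refinement {P, Q})"
    using assms(2,3) by (intro partition_on_common_refinement) (auto simp: countable_partition_def)
  ultimately show ?thesis
    using sub countable_subset[OF sub] order_trans[OF sub] by (simp add: countable_partition_def)
qed

text \<open>Packages the part of the definition that the comparison of sums uses, with absolute
  summability already turned into the plain summability that \<open>infsum_mono\<close> asks
  for.\<close>

lemma has_RL_integralE:
  assumes "has_RL_integral \<E> \<nu> g a" "0 < \<epsilon>"
  obtains P where "countable_partition \<E> P"
    and "\<And>R s. countable_partition \<E> R \<Longrightarrow> refines {0..} R P \<Longrightarrow> (\<And>X. X \<in> R \<Longrightarrow> s X \<in> X) \<Longrightarrow>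
      (\<lambda>X. g (s X) * \<nu> X) summable_on R"
    and "\<And>R s. countable_partition \<E> R \<Longrightarrow> refines {0..} R P \<Longrightarrow> (\<And>X. X \<in> R \<Longrightarrow> s X \<in> X) \<Longrightarrow>
      \<bar>(\<Sum>\<^sub>\<infinity>X\<in>R. g (s X) * \<nu> X) - a\<bar> < \<epsilon>"
proof -
  from assms obtain P where P: "countable_partition \<E> P"
    and sums: "\<forall>R. countable_partition \<E> R \<and> refines {0..} R P \<longrightarrow>
      (\<forall>X\<in>R. \<nu> X > 0 \<longrightarrow> bounded (g ` X)) \<and>
      (\<forall>s. (\<forall>X\<in>R. s X \<in> X) \<longrightarrow> (\<lambda>X. \<bar>g (s X) * \<nu> X\<bar>) summable_on R \<and>
        \<bar>(\<Sum>\<^sub>\<infinity>X\<in>R. g (s X) * \<nu> X) - a\<bar> < \<epsilon>)"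
    unfolding has_RL_integral_def by (elim allE[of _ \<epsilon>] impE exE conjE) (assumption, rule that)
  show thesis
  proof (rule that[OF P])
    fix R and s :: "real set \<Rightarrow> real"
    assume "countable_partition \<E> R" "refines {0..} R P" "\<And>X. X \<in> R \<Longrightarrow> s X \<in> X"
    then have "(\<lambda>X. \<bar>g (s X) * \<nu> X\<bar>) summable_on R"
      and "\<bar>(\<Sum>\<^sub>\<infinity>X\<in>R. g (s X) * \<nu> X) - a\<bar> < \<epsilon>"
      using sums by simp_all
    then show "(\<lambda>X. g (s X) * \<nu> X) summable_on R"
      and "\<bar>(\<Sum>\<^sub>\<infinity>X\<in>R. g (s X) * \<nu> X) - a\<bar> < \<epsilon>"
      \<comment> \<open>\<open>summable_on\<close> means unconditional summability, which for real
        families is the same as absolute summability.\<close>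
      by (simp_all only: summable_on_iff_abs_summable_on_real[of "\<lambda>X. g (s X) * \<nu> X"] real_norm_def)
  qed
qed

text \<open>Phrased for arbitrary values \<open>a\<close> and \<open>b\<close> of the relation
  rather than for \<open>RL_integral\<close>, because uniqueness of the value is itself deduced from
  it.\<close>

lemma has_RL_integral_mono:
  assumes sa: "sigma_algebra {0..} \<E>"
    and \<nu>: "\<And>X. X \<in> \<E> \<Longrightarrow> 0 \<le> \<nu> X"
    and g: "has_RL_integral \<E> \<nu> g a" and h: "has_RL_integral \<E> \<nu> h b"
    and le: "\<And>x. 0 \<le> x \<Longrightarrow> g x \<le> h x"
  shows "a \<le> b"
proof (rule field_le_epsilon)
  fix e :: real assume "0 < e"
  \<comment> \<open>Each of the two sums contributes an error below \<open>e / 2\<close>.\<close>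
  then have e2: "0 < e / 2" by simp
  obtain P where P: "countable_partition \<E> P"
    and gP: "\<And>R s. countable_partition \<E> R \<Longrightarrow> refines {0..} R P \<Longrightarrow> (\<And>X. X \<in> R \<Longrightarrow> s X \<in> X) \<Longrightarrow>
      (\<lambda>X. g (s X) * \<nu> X) summable_on R"
      "\<And>R s. countable_partition \<E> R \<Longrightarrow> refines {0..} R P \<Longrightarrow> (\<And>X. X \<in> R \<Longrightarrow> s X \<in> X) \<Longrightarrow>
      \<bar>(\<Sum>\<^sub>\<infinity>X\<in>R. g (s X) * \<nu> X) - a\<bar> < e / 2"
    by (fact has_RL_integralE[OF g e2])
  obtain Q where Q: "countable_partition \<E> Q"
    and hQ: "\<And>R s. countable_partition \<E> R \<Longrightarrow> refines {0..} R Q \<Longrightarrow> (\<And>X. X \<in> R \<Longrightarrow> s X \<in> X) \<Longrightarrow>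
      (\<lambda>X. h (s X) * \<nu> X) summable_on R"
      "\<And>R s. countable_partition \<E> R \<Longrightarrow> refines {0..} R Q \<Longrightarrow> (\<And>X. X \<in> R \<Longrightarrow> s X \<in> X) \<Longrightarrow>
      \<bar>(\<Sum>\<^sub>\<infinity>X\<in>R. h (s X) * \<nu> X) - b\<bar> < e / 2"
    by (fact has_RL_integralE[OF h e2])
  define R where "R = common_refinement {P, Q}"
  have R: "countable_partition \<E> R"
    unfolding R_def using sa P Q by (rule countable_partition_common_refinement)
  have RP: "refines {0..} R P" and RQ: "refines {0..} R Q"
    unfolding R_def using P Q
    by (auto intro!: refines_common_refinement simp: countable_partition_def)
  \<comment> \<open>Any choice of points will do, as long as both sums use the same one; it exists
    because blocks are nonempty.\<close>
  define s :: "real set \<Rightarrow> real" where "s X = (SOME x. x \<in> X)" for X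
  have s: "s X \<in> X" if "X \<in> R" for X
    using R that unfolding s_def
    by (auto simp: countable_partition_def partition_on_def some_in_eq)
  have "(\<Sum>\<^sub>\<infinity>X\<in>R. g (s X) * \<nu> X) \<le> (\<Sum>\<^sub>\<infinity>X\<in>R. h (s X) * \<nu> X)"
  proof (rule infsum_mono)
    show "(\<lambda>X. g (s X) * \<nu> X) summable_on R"
      using R RP s by (rule gP(1))
    show "(\<lambda>X. h (s X) * \<nu> X) summable_on R"
      using R RQ s by (rule hQ(1))
  next
    fix X assume X: "X \<in> R"
    then have "X \<in> \<E>" "X \<subseteq> {0..}"
      using R by (auto simp: countable_partition_def partition_on_def)
    \<comment> \<open>The chosen point lies in \<open>{0..}\<close>, where \<open>g\<close> is at
      most \<open>h\<close>.\<close>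
    then show "g (s X) * \<nu> X \<le> h (s X) * \<nu> X"
      using s[OF X] by (intro mult_right_mono le \<nu>) auto
  qed
  moreover have "\<bar>(\<Sum>\<^sub>\<infinity>X\<in>R. g (s X) * \<nu> X) - a\<bar> < e / 2"
    using R RP s by (rule gP(2))
  moreover have "\<bar>(\<Sum>\<^sub>\<infinity>X\<in>R. h (s X) * \<nu> X) - b\<bar> < e / 2"
    using R RQ s by (rule hQ(2))
  ultimately show "a \<le> b + e" by linarith
qed

lemma RL_integral_eqI:
  assumes "sigma_algebra {0..} \<E>" "\<And>X. X \<in> \<E> \<Longrightarrow> 0 \<le> \<nu> X" "has_RL_integral \<E> \<nu> g a"
  shows "RL_integral \<E> \<nu> g = a"
  unfolding RL_integral_def
proof (rule the_equality)
  fix b assume b: "has_RL_integral \<E> \<nu> g b"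
  \<comment> \<open>Monotonicity with both integrands equal to \<open>g\<close>, applied in both
    directions.\<close>
  show "b = a"
    using has_RL_integral_mono[OF assms(1,2) b assms(3)]
      has_RL_integral_mono[OF assms(1,2,3) b] by simp
qed (fact assms(3))

text \<open>Since \<open>\<mu>\<close> is monotone only on members of \<open>\<C>\<close>, both
  intersections must first be shown to lie there; for the level set this uses
  \<open>0 \<le> \<alpha>\<close>.\<close>

lemma level_fun_mono:
  assumes "sigma_algebra S \<C>" "fuzzy_measure \<C> \<mu>" "nonneg_measurable S \<C> f"
    and "A \<in> \<C>" "B \<in> \<C>" "A \<subseteq> B" "0 \<le> \<alpha>"
  shows "level_fun S \<mu> A f \<alpha> \<le> level_fun S \<mu> B f \<alpha>"
proof -
  interpret sigma_algebra S \<C> by fact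
  have "level_set S f \<alpha> \<in> \<C>"
    using assms(3,7) by (simp add: nonneg_measurable_def)
  then have "level_set S f \<alpha> \<inter> A \<in> \<C>" "level_set S f \<alpha> \<inter> B \<in> \<C>"
    using assms(4,5) by auto
  moreover have "level_set S f \<alpha> \<inter> A \<subseteq> level_set S f \<alpha> \<inter> B"
    using assms(6) by auto
  ultimately show ?thesis
    using assms(2) unfolding fuzzy_measure_def level_fun_def by blast
qed

theorem proposition3p10:
  fixes S :: "'a set" and \<C> :: "'a set set" and \<E> :: "real set set"
    and \<mu> :: "'a set \<Rightarrow> real" and \<nu> :: "real set \<Rightarrow> real"
    and f :: "'a \<Rightarrow> real" and A B :: "'a set"
  assumes "S \<noteq> {}" and "infinite S"
    and "sigma_algebra S \<C>"
    and "sigma_algebra {0..} \<E>" and "{0} \<in> \<E>"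
    and "fuzzy_measure \<C> \<mu>"
    and "nonneg_set_function \<E> \<nu>"
    and "nonneg_measurable S \<C> f"
    and "A \<in> \<C>" and "B \<in> \<C>" and "A \<subseteq> B"
    and "f \<in> G_RL S \<C> \<E> \<nu> \<mu> A \<inter> G_RL S \<C> \<E> \<nu> \<mu> B"
  shows "decomp_integral S \<E> \<nu> \<mu> A f \<le> decomp_integral S \<E> \<nu> \<mu> B f"
proof -
  have \<nu>: "\<And>X. X \<in> \<E> \<Longrightarrow> 0 \<le> \<nu> X"
    using assms(7) by (simp add: nonneg_set_function_def)
  obtain a b where a: "has_RL_integral \<E> \<nu> (level_fun S \<mu> A f) a"
    and b: "has_RL_integral \<E> \<nu> (level_fun S \<mu> B f) b"
    using assms(12) by (auto simp: G_RL_def decomp_integrable_def RL_integrable_def)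
  have "a \<le> b"
    using assms(4) \<nu> a b level_fun_mono[OF assms(3,6,8-11)] by (rule has_RL_integral_mono)
  then show ?thesis
    unfolding decomp_integral_def
    using RL_integral_eqI[OF assms(4) \<nu> a] RL_integral_eqI[OF assms(4) \<nu> b] by simp
qed

end
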